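(* Let $\rho:\mathbb{R}^2\to[0,\infty)$ be a probability density with respect to Lebesgue measure $dq\,dp$, with finite variances of $q$ and $p$ and with $\rho\ln\rho$ integrable. Let $\sigma_q,\sigma_p$ be the standard deviations of $q$ and $p$ under $\rho$, and let $I_0=I[\rho]$ be the Shannon/Gibbs entropy of $\rho$. Then $$\sigma_q\,\sigma_p\;\ge\;\frac{e^{I_0}}{2\pi e}.$$ Furthermore, equality holds if $\rho$ is the product of two Gaussian densities, one in $q$ and one in $p$.
   Context: Entropy: $I[\rho]=-\int_{\mathbb{R}^2}\rho\ln\rho\,dq\,dp$, with $0\ln0=0$. Here $\sigma_q^2=\int(q-\mu_q)^2\rho\,dq\,dp$ with $\mu_q=\int q\,\rho\,dq\,dp$, and similarly for $\sigma_p$, $\mu_p$. *)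

theory Defs
  imports "HOL-Probability.Distributions"
begin

text \<open>A point \<open>z = (q, p)\<close> of the phase plane has type \<^typ>\<open>real \<times> real\<close>, so \<open>q\<close> and \<open>p\<close> are the
  observables \<^const>\<open>fst\<close> and \<^const>\<open>snd\<close>. All integrals are Lebesgue integrals over the plane, and
  densities are only required to be Lebesgue (not necessarily Borel) measurable.\<close>

definition prob_density :: "(real \<times> real \<Rightarrow> real) \<Rightarrow> bool" where
  "prob_density \<rho> \<longleftrightarrow>
     (\<forall>z. 0 \<le> \<rho> z) \<and> integrable lebesgue \<rho> \<and> (\<integral>z. \<rho> z \<partial>lebesgue) = 1"

definition mean :: "(real \<times> real \<Rightarrow> real) \<Rightarrow> (real \<times> real \<Rightarrow> real) \<Rightarrow> real" where
  "mean \<rho> f = (\<integral>z. f z * \<rho> z \<partial>lebesgue)"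

definition density_variance :: "(real \<times> real \<Rightarrow> real) \<Rightarrow> (real \<times> real \<Rightarrow> real) \<Rightarrow> real" where
  "density_variance \<rho> f = (\<integral>z. (f z - mean \<rho> f)\<^sup>2 * \<rho> z \<partial>lebesgue)"

text \<open>The Bochner integral of a non-integrable function is \<open>0\<close>, so the existence of the mean and
  the finiteness of the variance have to be stated as integrability.\<close>

definition finite_variance :: "(real \<times> real \<Rightarrow> real) \<Rightarrow> (real \<times> real \<Rightarrow> real) \<Rightarrow> bool" where
  "finite_variance \<rho> f \<longleftrightarrow>
     integrable lebesgue (\<lambda>z. f z * \<rho> z) \<and>
     integrable lebesgue (\<lambda>z. (f z - mean \<rho> f)\<^sup>2 * \<rho> z)"

definition std_dev :: "(real \<times> real \<Rightarrow> real) \<Rightarrow> (real \<times> real \<Rightarrow> real) \<Rightarrow> real" where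
  "std_dev \<rho> f = sqrt (density_variance \<rho> f)"

text \<open>The convention \<open>0 ln 0 = 0\<close> holds because of the factor \<open>\<rho> z\<close>: \<^const>\<open>ln\<close> is total on the
  reals.\<close>

definition shannon_entropy :: "(real \<times> real \<Rightarrow> real) \<Rightarrow> real" where
  "shannon_entropy \<rho> = - (\<integral>z. \<rho> z * ln (\<rho> z) \<partial>lebesgue)"

end

theory Submission
  imports Defs
begin

text \<open>By Gibbs' inequality, the entropy of \<open>\<rho>\<close> is at most its cross entropy relative to the product
  of Gaussians that has the same means and variances as \<open>\<rho>\<close>. The logarithm of that product is a
  quadratic polynomial, so the cross entropy depends on \<open>\<rho>\<close> only through these moments and equals
  \<open>ln (2 \<pi> \<sigma>\<^sub>q \<sigma>\<^sub>p) + 1\<close>. If \<open>\<rho>\<close> is itself a product of Gaussians, it coincides with its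
  comparison density, and the cross entropy is the entropy.\<close>

text \<open>Fubini for a function with separated variables. It reduces every moment of a product of
  Gaussians to one-dimensional Gaussian moments.\<close>

lemma has_bochner_integral_lebesgue_product:
  fixes f g :: "real \<Rightarrow> real"
  assumes f: "has_bochner_integral lborel f a" and g: "has_bochner_integral lborel g b"
  shows "has_bochner_integral lebesgue (\<lambda>z. f (fst z) * g (snd z)) (a * b)"
proof -
  let ?h = "\<lambda>z. f (fst z) * g (snd z)"
  have int [simp]: "integrable lborel f" "integrable lborel g"
    and eq: "integral\<^sup>L lborel f = a" "integral\<^sup>L lborel g = b"
    using f g by (auto simp: has_bochner_integral_iff)
  have [measurable]: "f \<in> borel_measurable lborel" "g \<in> borel_measurable lborel"
    by (fact int[THEN borel_measurable_integrable])+
  have meas: "?h \<in> borel_measurable (lborel \<Otimes>\<^sub>M lborel)"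
    by measurable
  have prod: "integrable (lborel \<Otimes>\<^sub>M lborel) ?h"
    by (rule lborel_pair.Fubini_integrable[OF meas]) (simp_all add: abs_mult)
  have "integral\<^sup>L (lborel \<Otimes>\<^sub>M lborel) ?h = a * b"
    using lborel_pair.integral_fst'[OF prod] by (simp add: eq)
  \<comment> \<open>The product of the two line measures is \<open>lborel\<close> on the plane, and
    \<open>lebesgue\<close> is its completion. Completing a measure keeps both integrability and
    integral of a function already measurable for it.\<close>
  with prod meas show ?thesis
    by (simp add: has_bochner_integral_iff lborel_prod integrable_completion integral_completion)
qed

text \<open>Multiplying \<open>ln t \<le> t - 1\<close> at \<open>t = g x / f x\<close> by
  \<open>f x\<close> bounds the difference of the integrands by \<open>g x - f x\<close>, whose
  integral is at most 0 by \<open>le\<close>.\<close>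

lemma Gibbs_inequality:
  fixes f g :: "'a \<Rightarrow> real"
  assumes f: "integrable M f" and g: "integrable M g"
    and ff: "integrable M (\<lambda>x. f x * ln (f x))" and fg: "integrable M (\<lambda>x. f x * ln (g x))"
    and nonneg: "\<And>x. 0 \<le> f x" and pos: "\<And>x. 0 < g x"
    and le: "integral\<^sup>L M g \<le> integral\<^sup>L M f"
  shows "(\<integral>x. f x * ln (g x) \<partial>M) \<le> (\<integral>x. f x * ln (f x) \<partial>M)"
proof -
  have pointwise: "f x * ln (g x) - f x * ln (f x) \<le> g x - f x" for x
  proof (cases "f x = 0")
    case True
    \<comment> \<open>Where \<open>f\<close> vanishes the quotient is unusable, but both products on
      the left are 0 and the right side is \<open>g x\<close>.\<close>
    then show ?thesis using pos[of x] by simp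
  next
    case False
    with nonneg[of x] have fx: "0 < f x" by simp
    have "ln (g x / f x) \<le> g x / f x - 1"
      using fx pos[of x] by (intro ln_le_minus_one) simp
    then have "f x * ln (g x / f x) \<le> f x * (g x / f x - 1)"
      using fx by (intro mult_left_mono) auto
    then show ?thesis
      using fx pos[of x] by (simp add: ln_div algebra_simps)
  qed
  have "(\<integral>x. f x * ln (g x) - f x * ln (f x) \<partial>M) \<le> (\<integral>x. g x - f x \<partial>M)"
    using f g ff fg pointwise by (intro integral_mono) auto
  then show ?thesis
    using f g ff fg le by simp
qed

definition product_normal_density ::
    "real \<Rightarrow> real \<Rightarrow> real \<Rightarrow> real \<Rightarrow> real \<times> real \<Rightarrow> real" where
  "product_normal_density \<mu> \<sigma> \<nu> \<tau> z = normal_density \<mu> \<sigma> (fst z) * normal_density \<nu> \<tau> (snd z)"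

lemma ln_normal_density:
  assumes "0 < \<sigma>"
  shows "ln (normal_density \<mu> \<sigma> x) = - ln (2 * pi * \<sigma>\<^sup>2) / 2 - (x - \<mu>)\<^sup>2 / (2 * \<sigma>\<^sup>2)"
  using assms by (simp add: normal_density_def ln_mult ln_div ln_sqrt field_simps)

lemma ln_product_normal_density:
  assumes "0 < \<sigma>" "0 < \<tau>"
  shows "ln (product_normal_density \<mu> \<sigma> \<nu> \<tau> z) =
    - ln (2 * pi * \<sigma> * \<tau>) - (fst z - \<mu>)\<^sup>2 / (2 * \<sigma>\<^sup>2) - (snd z - \<nu>)\<^sup>2 / (2 * \<tau>\<^sup>2)"
proof -
  have "ln (product_normal_density \<mu> \<sigma> \<nu> \<tau> z) =
      ln (normal_density \<mu> \<sigma> (fst z)) + ln (normal_density \<nu> \<tau> (snd z))"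
    using normal_density_pos[OF assms(1), of \<mu> "fst z"] normal_density_pos[OF assms(2), of \<nu> "snd z"]
    unfolding product_normal_density_def by (simp add: ln_mult)
  \<comment> \<open>The normalising constants merge: \<open>2 * pi * \<sigma> * \<tau>\<close> is
    the geometric mean of \<open>2 * pi * \<sigma>^2\<close> and
    \<open>2 * pi * \<tau>^2\<close>.\<close>
  moreover have "ln (2 * pi * \<sigma> * \<tau>) = ln (2 * pi * \<sigma>\<^sup>2) / 2 + ln (2 * pi * \<tau>\<^sup>2) / 2"
    using assms by (simp add: ln_mult power2_eq_square field_simps)
  ultimately show ?thesis
    using assms by (simp add: ln_normal_density)
qed

text \<open>Each integral splits into a moment of one factor times the total mass 1 of the other.
  The parameters are thus recovered from the density, which is what the equality case rests
  on.\<close>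

lemma
  assumes "0 < \<sigma>" "0 < \<tau>"
  shows product_normal_density_pos: "0 < product_normal_density \<mu> \<sigma> \<nu> \<tau> z"
    and has_bochner_integral_product_normal_density:
      "has_bochner_integral lebesgue (product_normal_density \<mu> \<sigma> \<nu> \<tau>) 1"
    and mean_product_normal_density:
      "mean (product_normal_density \<mu> \<sigma> \<nu> \<tau>) fst = \<mu>"
      "mean (product_normal_density \<mu> \<sigma> \<nu> \<tau>) snd = \<nu>"
    and std_dev_product_normal_density:
      "std_dev (product_normal_density \<mu> \<sigma> \<nu> \<tau>) fst = \<sigma>"
      "std_dev (product_normal_density \<mu> \<sigma> \<nu> \<tau>) snd = \<tau>"
proof -
  let ?\<rho> = "product_normal_density \<mu> \<sigma> \<nu> \<tau>"
  have m0: "has_bochner_integral lborel (normal_density m s) 1" if "0 < s" for m s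
    using that by (simp add: has_bochner_integral_iff)
  have m1: "has_bochner_integral lborel (\<lambda>x. normal_density m s x * x) m" if "0 < s" for m s
    using that by (rule normal_moment_nz_1)
  have m2: "has_bochner_integral lborel (\<lambda>x. normal_density m s x * (x - m)\<^sup>2) (s\<^sup>2)"
    if "0 < s" for m s
    \<comment> \<open>The even central moment of order \<open>2 * k\<close> at \<open>k = 1\<close>
      is \<open>fact 2 / (2 / s^2)\<close>, that is \<open>s^2\<close>.\<close>
    using normal_moment_even[OF that, of m 1] by simp
  note product = has_bochner_integral_lebesgue_product
  show "0 < ?\<rho> z"
    using assms by (simp add: product_normal_density_def normal_density_pos)
  show "has_bochner_integral lebesgue ?\<rho> 1"
    using product[OF m0 m0, OF assms] by (simp add: product_normal_density_def[abs_def])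
  show mean_fst: "mean ?\<rho> fst = \<mu>"
    using has_bochner_integral_integral_eq[OF product[OF m1 m0, OF assms, of \<mu> \<nu>]]
    by (simp add: mean_def product_normal_density_def ac_simps)
  show mean_snd: "mean ?\<rho> snd = \<nu>"
    using has_bochner_integral_integral_eq[OF product[OF m0 m1, OF assms, of \<mu> \<nu>]]
    by (simp add: mean_def product_normal_density_def ac_simps)
  show "std_dev ?\<rho> fst = \<sigma>"
    using has_bochner_integral_integral_eq[OF product[OF m2 m0, OF assms, of \<mu> \<nu>]] assms
    by (simp add: std_dev_def density_variance_def mean_fst product_normal_density_def ac_simps)
  show "std_dev ?\<rho> snd = \<tau>"
    using has_bochner_integral_integral_eq[OF product[OF m0 m2, OF assms, of \<mu> \<nu>]] assms
    by (simp add: std_dev_def density_variance_def mean_snd product_normal_density_def ac_simps)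
qed

text \<open>Zero variance would force \<rho> to vanish almost everywhere off the level set of
  \<open>f\<close> at its mean. That set is null by \<open>nonconst\<close>, so \<rho> would have
  mass 0. Positivity makes the comparison Gaussians nondegenerate.\<close>

lemma std_dev_pos:
  assumes \<rho>: "prob_density \<rho>" and fin: "finite_variance \<rho> f"
    and nonconst: "\<And>c. AE z in lebesgue. f z \<noteq> c"
  shows "0 < std_dev \<rho> f"
proof -
  have nonneg: "\<And>z. 0 \<le> \<rho> z"
    using \<rho> unfolding prob_density_def by blast
  have int: "integrable lebesgue (\<lambda>z. (f z - mean \<rho> f)\<^sup>2 * \<rho> z)"
    using fin by (simp add: finite_variance_def)
  have "density_variance \<rho> f \<noteq> 0"
  proof
    assume "density_variance \<rho> f = 0"
    then have "AE z in lebesgue. (f z - mean \<rho> f)\<^sup>2 * \<rho> z = 0"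
      unfolding density_variance_def
      by (subst (asm) integral_nonneg_eq_0_iff_AE[OF int]) (simp_all add: nonneg)
    with nonconst[of "mean \<rho> f"] have "AE z in lebesgue. \<rho> z = 0"
      by eventually_elim auto
    then have "(\<integral>z. \<rho> z \<partial>lebesgue) = 0"
      by (rule integral_eq_zero_AE)
    with \<rho> show False
      by (simp add: prob_density_def)
  qed
  moreover have "0 \<le> density_variance \<rho> f"
    unfolding density_variance_def by (intro integral_nonneg_AE) (simp add: nonneg)
  ultimately show ?thesis
    by (simp add: std_dev_def)
qed

text \<open>The coordinates are inner products with the standard basis vectors, so their level sets
  are hyperplanes and hence negligible.\<close>

lemma AE_lebesgue_fst_neq: "AE z in lebesgue. fst (z :: real \<times> real) \<noteq> c"
  and AE_lebesgue_snd_neq: "AE z in lebesgue. snd (z :: real \<times> real) \<noteq> c"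
proof -
  have "negligible {z :: real \<times> real. z \<bullet> (1, 0) = c}" "negligible {z :: real \<times> real. z \<bullet> (0, 1) = c}"
    by (rule negligible_standard_hyperplane, simp add: Basis_prod_def)+
  then have "{z :: real \<times> real. fst z = c} \<in> null_sets lebesgue"
    "{z :: real \<times> real. snd z = c} \<in> null_sets lebesgue"
    by (simp_all add: negligible_iff_null_sets inner_prod_def)
  then show "AE z in lebesgue. fst (z :: real \<times> real) \<noteq> c"
    "AE z in lebesgue. snd (z :: real \<times> real) \<noteq> c"
    by (auto intro: AE_I')
qed

text \<open>The constant term of \<open>ln (g z)\<close> is weighted by the mass 1, and each
  quadratic term contributes -1/2, a variance divided by minus twice itself.\<close>

lemma cross_entropy_product_normal_density:
  assumes \<rho>: "prob_density \<rho>" and fin: "finite_variance \<rho> fst" "finite_variance \<rho> snd"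
    and pos: "0 < std_dev \<rho> fst" "0 < std_dev \<rho> snd"
  defines "g \<equiv> product_normal_density (mean \<rho> fst) (std_dev \<rho> fst) (mean \<rho> snd) (std_dev \<rho> snd)"
  shows "has_bochner_integral lebesgue (\<lambda>z. \<rho> z * ln (g z))
    (- ln (2 * pi * std_dev \<rho> fst * std_dev \<rho> snd) - 1)"
proof -
  let ?\<sigma> = "std_dev \<rho> fst" and ?\<tau> = "std_dev \<rho> snd"
  let ?L = "ln (2 * pi * ?\<sigma> * ?\<tau>)"
  have mass: "has_bochner_integral lebesgue \<rho> 1"
    using \<rho> by (simp add: prob_density_def has_bochner_integral_iff)
  \<comment> \<open>A positive square root has a positive radicand, so squaring
    \<open>std_dev \<rho> f\<close> gives back the variance.\<close>
  have second_moment: "has_bochner_integral lebesgue (\<lambda>z. (f z - mean \<rho> f)\<^sup>2 * \<rho> z) ((std_dev \<rho> f)\<^sup>2)"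
    if "finite_variance \<rho> f" "0 < std_dev \<rho> f" for f
    using that
    by (simp add: finite_variance_def std_dev_def density_variance_def has_bochner_integral_iff)
  have "has_bochner_integral lebesgue
      (\<lambda>z. - ?L * \<rho> z - 1 / (2 * ?\<sigma>\<^sup>2) * ((fst z - mean \<rho> fst)\<^sup>2 * \<rho> z)
        - 1 / (2 * ?\<tau>\<^sup>2) * ((snd z - mean \<rho> snd)\<^sup>2 * \<rho> z))
      (- ?L * 1 - 1 / (2 * ?\<sigma>\<^sup>2) * ?\<sigma>\<^sup>2 - 1 / (2 * ?\<tau>\<^sup>2) * ?\<tau>\<^sup>2)"
    using fin pos
    by (intro has_bochner_integral_diff has_bochner_integral_mult_right mass second_moment)
  moreover have "\<rho> z * ln (g z) =
      - ?L * \<rho> z - 1 / (2 * ?\<sigma>\<^sup>2) * ((fst z - mean \<rho> fst)\<^sup>2 * \<rho> z)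
        - 1 / (2 * ?\<tau>\<^sup>2) * ((snd z - mean \<rho> snd)\<^sup>2 * \<rho> z)" for z
    using pos by (simp add: g_def ln_product_normal_density algebra_simps)
  moreover have "- ?L * 1 - 1 / (2 * ?\<sigma>\<^sup>2) * ?\<sigma>\<^sup>2 - 1 / (2 * ?\<tau>\<^sup>2) * ?\<tau>\<^sup>2 = - ?L - 1"
    using pos by simp
  ultimately show ?thesis
    by (simp only:)
qed

theorem proposition6:
  fixes \<rho> :: "real \<times> real \<Rightarrow> real"
  assumes "prob_density \<rho>"
    and "finite_variance \<rho> fst"
    and "finite_variance \<rho> snd"
    and "integrable lebesgue (\<lambda>z. \<rho> z * ln (\<rho> z))"
  shows "std_dev \<rho> fst * std_dev \<rho> snd \<ge> exp (shannon_entropy \<rho>) / (2 * pi * exp 1) \<and>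
    ((\<exists>\<mu>\<^sub>1 s\<^sub>1 \<mu>\<^sub>2 s\<^sub>2. s\<^sub>1 > 0 \<and> s\<^sub>2 > 0 \<and>
        (\<forall>q p. \<rho> (q, p) = normal_density \<mu>\<^sub>1 s\<^sub>1 q * normal_density \<mu>\<^sub>2 s\<^sub>2 p)) \<longrightarrow>
      std_dev \<rho> fst * std_dev \<rho> snd = exp (shannon_entropy \<rho>) / (2 * pi * exp 1))"
proof (intro conjI impI)
  let ?\<sigma> = "std_dev \<rho> fst" and ?\<tau> = "std_dev \<rho> snd"
  let ?g = "product_normal_density (mean \<rho> fst) ?\<sigma> (mean \<rho> snd) ?\<tau>"
  have pos: "0 < ?\<sigma>" "0 < ?\<tau>"
    using assms(1-3) by (auto intro: std_dev_pos AE_lebesgue_fst_neq AE_lebesgue_snd_neq)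
  have cross: "integrable lebesgue (\<lambda>z. \<rho> z * ln (?g z))"
    "(\<integral>z. \<rho> z * ln (?g z) \<partial>lebesgue) = - ln (2 * pi * ?\<sigma> * ?\<tau>) - 1"
    using cross_entropy_product_normal_density[OF assms(1-3) pos]
    by (simp_all add: has_bochner_integral_iff)
  have g: "integrable lebesgue ?g" "integral\<^sup>L lebesgue ?g = 1"
    using has_bochner_integral_product_normal_density[OF pos]
    by (simp_all add: has_bochner_integral_iff)
  \<comment> \<open>The factor \<open>2 * pi * exp 1\<close> is exactly what exponentiating the
    cross entropy adds to the product of the standard deviations.\<close>
  have exp_cross: "exp (ln (2 * pi * ?\<sigma> * ?\<tau>) + 1) / (2 * pi * exp 1) = ?\<sigma> * ?\<tau>"
    using pos by (simp add: exp_add)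
  have "(\<integral>z. \<rho> z * ln (?g z) \<partial>lebesgue) \<le> (\<integral>z. \<rho> z * ln (\<rho> z) \<partial>lebesgue)"
    using assms(1) g unfolding prob_density_def
    by (intro Gibbs_inequality assms(4) cross(1) product_normal_density_pos[OF pos]) auto
  then have "shannon_entropy \<rho> \<le> ln (2 * pi * ?\<sigma> * ?\<tau>) + 1"
    by (simp add: shannon_entropy_def cross(2))
  then have "exp (shannon_entropy \<rho>) / (2 * pi * exp 1) \<le>
      exp (ln (2 * pi * ?\<sigma> * ?\<tau>) + 1) / (2 * pi * exp 1)"
    by (intro divide_right_mono) auto
  then show "exp (shannon_entropy \<rho>) / (2 * pi * exp 1) \<le> ?\<sigma> * ?\<tau>"
    by (simp only: exp_cross)
  assume "\<exists>\<mu>\<^sub>1 s\<^sub>1 \<mu>\<^sub>2 s\<^sub>2. s\<^sub>1 > 0 \<and> s\<^sub>2 > 0 \<and>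
    (\<forall>q p. \<rho> (q, p) = normal_density \<mu>\<^sub>1 s\<^sub>1 q * normal_density \<mu>\<^sub>2 s\<^sub>2 p)"
  then obtain \<mu> s \<nu> t where st: "0 < s" "0 < t" and "\<rho> = product_normal_density \<mu> s \<nu> t"
    by (auto simp: product_normal_density_def fun_eq_iff)
  \<comment> \<open>The parameters of \<open>?g\<close> are computed from \<rho>, and for this
    \<rho> the moment identities return \<open>\<mu>\<close>, \<open>s\<close>, \<open>\<nu>\<close>
    and \<open>t\<close>.\<close>
  then have "?g = \<rho>"
    by (simp add: mean_product_normal_density std_dev_product_normal_density)
  with cross(2) have "shannon_entropy \<rho> = ln (2 * pi * ?\<sigma> * ?\<tau>) + 1"
    by (simp add: shannon_entropy_def)
  then show "?\<sigma> * ?\<tau> = exp (shannon_entropy \<rho>) / (2 * pi * exp 1)"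
    by (simp only: exp_cross)
qed

end
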